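(* Let $K$ be a field, let $1\leq m\leq n$, let $\mathfrak{p}=(x_1,\dots,x_m)\subset K[x_1,\dots,x_n]$ be a monomial prime ideal, and let $J=(x_1^m,\dots,x_m^m)$. Then $J$ is a demotion of $\mathfrak{p}^m$. In particular, if $m>1$, then $J$ is a proper demotion of $\mathfrak{p}^m$.
   Context: For ideals $J\subseteq I$ in a commutative Noetherian ring $R$, $J$ is a demotion of $I$ if $I^rJ^s=I^{r+s}\cap J^s$ for all integers $r,s\geq 0$ (with $I^0=J^0=R$); it is a proper demotion of $I$ if moreover $J\neq I$. The same integer $m$ is both the number of variables generating $\mathfrak{p}$ and the exponent. *)

theory Defs
  imports "HOL-Algebra.Algebra" "HOL-Library.Poly_Mapping"
begin

text \<open>
  Polynomials over the field \<open>'k\<close> in variables indexed by \<open>nat\<close> are finitely supported maps from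
  exponent vectors to coefficients; their \<open>(+)\<close> and \<open>(*)\<close> are pointwise addition and convolution.
  The ring \<open>K[x\<^sub>1, \<dots>, x\<^sub>n]\<close> consists of those in which only \<open>x\<^sub>1, \<dots>, x\<^sub>n\<close> occur.
\<close>

definition mpoly_ring :: "nat \<Rightarrow> ((nat \<Rightarrow>\<^sub>0 nat) \<Rightarrow>\<^sub>0 'k::field) ring" where
  "mpoly_ring n =
     \<lparr>carrier = {f. \<forall>a \<in> Poly_Mapping.keys f. Poly_Mapping.keys a \<subseteq> {1..n}},
      monoid.mult = (*), one = 1, ring.zero = 0, add = (+)\<rparr>"

definition Var :: "nat \<Rightarrow> (nat \<Rightarrow>\<^sub>0 nat) \<Rightarrow>\<^sub>0 'k::field" where
  "Var i = Poly_Mapping.single (Poly_Mapping.single i 1) 1"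

text \<open>
  In the monoid \<^term>\<open>ideals_set R\<close> the multiplication is the ideal product and the unit is
  \<^term>\<open>carrier R\<close>, so the zeroth power of every ideal is the whole ring.
\<close>

abbreviation ideal_power :: "('a, 'b) ring_scheme \<Rightarrow> 'a set \<Rightarrow> nat \<Rightarrow> 'a set" where
  "ideal_power R I r \<equiv> I [^]\<^bsub>ideals_set R\<^esub> r"

definition demotion :: "('a, 'b) ring_scheme \<Rightarrow> 'a set \<Rightarrow> 'a set \<Rightarrow> bool" where
  "demotion R J I \<longleftrightarrow>
     cring R \<and> noetherian_ring R \<and> ideal I R \<and> ideal J R \<and> J \<subseteq> I \<and>
     (\<forall>r s. ideal_power R I r \<cdot>\<^bsub>R\<^esub> ideal_power R J s
            = ideal_power R I (r + s) \<inter> ideal_power R J s)"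

definition proper_demotion :: "('a, 'b) ring_scheme \<Rightarrow> 'a set \<Rightarrow> 'a set \<Rightarrow> bool" where
  "proper_demotion R J I \<longleftrightarrow> demotion R J I \<and> J \<noteq> I"

end

theory Submission
  imports Defs "HOL-Library.Set_Algebras"
begin

text \<open>
  Both \<open>\<pp>\<close> and \<open>J\<close> are generated by monomials, so each ideal in the statement is spanned over \<open>K\<close> by the
  monomials it contains, and the demotion identity becomes an identity between sets of exponent
  vectors. Products of such spans correspond to sums of the sets of exponents
  (\<open>ideal_prod_monom_span\<close>). Write \<open>wt m q a = (\<Sum>i=1..m. a\<^sub>i div q)\<close> for the largest number of factors
  \<open>x\<^sub>1\<^sup>q, \<dots>, x\<^sub>m\<^sup>q\<close>, counted with multiplicity, that can be split off the monomial \<open>x\<^sup>a\<close>. Then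
  the \<open>k\<close>-th power of \<open>(x\<^sub>1\<^sup>q, \<dots>, x\<^sub>m\<^sup>q)\<close> is spanned by the \<open>x\<^sup>a\<close> with \<open>wt m q a \<ge> k\<close>. Taking \<open>q = 1\<close> gives
  the powers of \<open>\<pp>\<close>, and \<open>q = m\<close> those of \<open>J\<close>.

  The nontrivial inclusion of the demotion identity is now immediate. A monomial in \<open>J\<^sup>s\<close> is a product
  \<open>x\<^sup>b x\<^sup>c\<close> in which \<open>x\<^sup>b\<close> is a product of exactly \<open>s\<close> of the generators \<open>x\<^sub>i\<^sup>m\<close>, hence has degree exactly
  \<open>m * s\<close> in \<open>x\<^sub>1, \<dots>, x\<^sub>m\<close>. If the whole monomial has degree at least \<open>m * (r + s)\<close>, then \<open>x\<^sup>c\<close> has degree at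
  least \<open>m * r\<close>, so it lies in \<open>(\<pp>\<^sup>m)\<^sup>r\<close> (\<open>degree_wt_exps_add\<close>). For \<open>m > 1\<close> the monomial
  \<open>x\<^sub>1\<^sup>m\<^sup>-\<^sup>1 x\<^sub>2\<close> lies in \<open>\<pp>\<^sup>m\<close> but not in \<open>J\<close>.

  The definition of a demotion also asks for a Noetherian ring, so Hilbert's basis theorem for
  \<open>K[x\<^sub>1, \<dots>, x\<^sub>n]\<close> is proved along the lines of Groebner bases. By Dickson's lemma, the leading exponents
  of an ideal, for the lexicographic order, are the multiples of finitely many of them. Polynomials
  that realise these finitely many exponents generate the ideal, because the leading
  term of any element can be cancelled by a multiple of one of them (\<open>ideal_eq_if_same_leads\<close>), and the
  lexicographic order is well-founded on exponents of \<open>n\<close> variables, again by Dickson's lemma.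
\<close>

abbreviation lookup :: "('a \<Rightarrow>\<^sub>0 'b::zero) \<Rightarrow> 'a \<Rightarrow> 'b" where
  "lookup \<equiv> Poly_Mapping.lookup"

abbreviation single :: "'a \<Rightarrow> 'b::zero \<Rightarrow> 'a \<Rightarrow>\<^sub>0 'b" where
  "single \<equiv> Poly_Mapping.single"

abbreviation keys :: "('a \<Rightarrow>\<^sub>0 'b::zero) \<Rightarrow> 'a set" where
  "keys \<equiv> Poly_Mapping.keys"

section \<open>Spans of monomials\<close>

definition exps :: "nat \<Rightarrow> (nat \<Rightarrow>\<^sub>0 nat) set" where
  "exps n = {a. keys a \<subseteq> {1..n}}"

definition monom_span :: "(nat \<Rightarrow>\<^sub>0 nat) set \<Rightarrow> ((nat \<Rightarrow>\<^sub>0 nat) \<Rightarrow>\<^sub>0 'k::field) set" where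
  "monom_span S = {f. keys f \<subseteq> S}"

lemma exps_iff: "a \<in> exps n \<longleftrightarrow> (\<forall>i. i \<notin> {1..n} \<longrightarrow> lookup a i = 0)"
  unfolding exps_def by (auto simp: in_keys_iff)

lemma zero_in_exps: "0 \<in> exps n"
  by (simp add: exps_iff)

lemma add_in_exps_iff: "a + b \<in> exps n \<longleftrightarrow> a \<in> exps n \<and> b \<in> exps n"
  by (auto simp: exps_iff lookup_add)

lemma single_in_exps: "i \<in> {1..n} \<Longrightarrow> single i k \<in> exps n"
  by (auto simp: exps_iff lookup_single)

lemma mpoly_ring_simps [simp]:
  "carrier (mpoly_ring n) = monom_span (exps n)"
  "f \<otimes>\<^bsub>mpoly_ring n\<^esub> g = f * g"
  "f \<oplus>\<^bsub>mpoly_ring n\<^esub> g = f + g"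
  "\<one>\<^bsub>mpoly_ring n\<^esub> = 1"
  "\<zero>\<^bsub>mpoly_ring n\<^esub> = 0"
  by (auto simp: mpoly_ring_def monom_span_def exps_def)

lemma mpoly_ring_power [simp]: "f [^]\<^bsub>mpoly_ring n\<^esub> (k::nat) = f ^ k"
  by (induction k) (simp_all add: nat_pow_def mult.commute)

lemma monom_span_mono: "S \<subseteq> T \<Longrightarrow> monom_span S \<subseteq> monom_span T"
  by (auto simp: monom_span_def)

lemma zero_in_monom_span: "0 \<in> monom_span S"
  by (simp add: monom_span_def)

lemma single_in_monom_span_iff: "single a c \<in> monom_span S \<longleftrightarrow> c = 0 \<or> a \<in> S"
  by (simp add: monom_span_def)

lemma add_in_monom_span: "f \<in> monom_span S \<Longrightarrow> g \<in> monom_span S \<Longrightarrow> f + g \<in> monom_span S"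
  using keys_add[of f g] by (auto simp: monom_span_def)

lemma uminus_in_monom_span: "f \<in> monom_span S \<Longrightarrow> - f \<in> monom_span S"
  by (auto simp: monom_span_def in_keys_iff)

lemma mult_in_monom_span:
  "f \<in> monom_span A \<Longrightarrow> g \<in> monom_span B \<Longrightarrow> f * g \<in> monom_span (A + B)"
  using keys_mult[of f g] by (fastforce simp: monom_span_def set_plus_def)

text \<open>
  A polynomial is the sum of its terms, so an additively closed set contains a monomial span as soon
  as it contains the terms.
\<close>

lemma monom_span_subsetI:
  assumes "0 \<in> G"
    and add: "\<And>f g. f \<in> G \<Longrightarrow> g \<in> G \<Longrightarrow> f + g \<in> G"
    and single: "\<And>a c. a \<in> S \<Longrightarrow> c \<noteq> 0 \<Longrightarrow> single a c \<in> G"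
  shows "monom_span S \<subseteq> G"
proof
  fix f :: "(nat \<Rightarrow>\<^sub>0 nat) \<Rightarrow>\<^sub>0 'a" assume f: "f \<in> monom_span S"
  have "(\<Sum>a\<in>A. single a (lookup f a)) \<in> G" if "finite A" "A \<subseteq> keys f" for A
    using that
  proof (induction A rule: finite_induct)
    case (insert a A)
    then show ?case using f
      by (auto simp: monom_span_def in_keys_iff intro!: add single)
  qed (simp add: \<open>0 \<in> G\<close>)
  moreover have "f = (\<Sum>a\<in>keys f. single a (lookup f a))"
    by (rule poly_mapping_eqI)
      (auto simp: lookup_sum lookup_single when_def in_keys_iff)
  ultimately show "f \<in> G"
    by (metis finite_keys order_refl)
qed

text \<open>
  An ideal product consists of sums of products \<open>f * g\<close>, the exponents of which lie in the Minkowski sum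
  \<open>A + B\<close>, while every term with exponent \<open>a + b\<close> is itself such a product.
\<close>

lemma ideal_prod_monom_span:
  "monom_span A \<cdot>\<^bsub>mpoly_ring n\<^esub> monom_span B
    = (monom_span (A + B) :: ((nat \<Rightarrow>\<^sub>0 nat) \<Rightarrow>\<^sub>0 'k::field) set)"
proof
  show "monom_span A \<cdot>\<^bsub>mpoly_ring n\<^esub> monom_span B \<subseteq> (monom_span (A + B) :: (_ \<Rightarrow>\<^sub>0 'k) set)"
  proof
    fix f :: "(nat \<Rightarrow>\<^sub>0 nat) \<Rightarrow>\<^sub>0 'k"
    assume "f \<in> monom_span A \<cdot>\<^bsub>mpoly_ring n\<^esub> monom_span B"
    then show "f \<in> monom_span (A + B)"
      by induction (simp_all add: mult_in_monom_span add_in_monom_span)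
  qed
  show "monom_span (A + B) \<subseteq> monom_span A \<cdot>\<^bsub>mpoly_ring n\<^esub> (monom_span B :: (_ \<Rightarrow>\<^sub>0 'k) set)"
    (is "_ \<subseteq> ?P")
  proof (rule monom_span_subsetI)
    show "(0 :: _ \<Rightarrow>\<^sub>0 'k) \<in> ?P"
      using ideal_prod.prod[OF zero_in_monom_span zero_in_monom_span, of "mpoly_ring n" A B] by simp
    show "f + g \<in> ?P" if "f \<in> ?P" "g \<in> ?P" for f g :: "(nat \<Rightarrow>\<^sub>0 nat) \<Rightarrow>\<^sub>0 'k"
      using ideal_prod.sum[OF that] by simp
    show "single e c \<in> ?P" if "e \<in> A + B" "c \<noteq> 0" for e and c :: 'k
    proof -
      obtain a b where ab: "a \<in> A" "b \<in> B" "e = a + b"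
        using \<open>e \<in> A + B\<close> by (auto simp: set_plus_def)
      have "single a 1 \<otimes>\<^bsub>mpoly_ring n\<^esub> single b c \<in> ?P"
        using ab by (intro ideal_prod.prod) (simp_all add: single_in_monom_span_iff)
      then show ?thesis
        using ab by (simp add: mult_single)
    qed
  qed
qed

lemma exps_add_exps: "exps n + exps n = exps n"
proof
  show "exps n + exps n \<subseteq> exps n"
    by (auto simp: set_plus_def add_in_exps_iff)
  show "exps n \<subseteq> exps n + exps n"
    using zero_in_exps[of n] by (metis add.right_neutral set_plus_intro subsetI)
qed

lemma cring_mpoly_ring: "cring (mpoly_ring n)"
proof (intro cringI abelian_groupI comm_monoidI)
  fix f :: "(nat \<Rightarrow>\<^sub>0 nat) \<Rightarrow>\<^sub>0 'a" assume "f \<in> carrier (mpoly_ring n)"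
  then show "\<exists>g\<in>carrier (mpoly_ring n). g \<oplus>\<^bsub>mpoly_ring n\<^esub> f = \<zero>\<^bsub>mpoly_ring n\<^esub>"
    by (intro bexI[of _ "- f"]) (simp_all add: uminus_in_monom_span)
next
  fix f g :: "(nat \<Rightarrow>\<^sub>0 nat) \<Rightarrow>\<^sub>0 'a"
  assume "f \<in> carrier (mpoly_ring n)" "g \<in> carrier (mpoly_ring n)"
  then show "f \<otimes>\<^bsub>mpoly_ring n\<^esub> g \<in> carrier (mpoly_ring n)"
    using mult_in_monom_span[of f "exps n" g "exps n"] by (simp add: exps_add_exps)
next
  show "\<one>\<^bsub>mpoly_ring n\<^esub> \<in> carrier (mpoly_ring n)"
    by (simp add: monom_span_def zero_in_exps)
qed (simp_all add: add_in_monom_span zero_in_monom_span algebra_simps)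

lemma ideal_monom_span:
  assumes "S \<subseteq> exps n" and "S + exps n \<subseteq> S"
  shows "ideal (monom_span S) (mpoly_ring n)"
proof (rule idealI)
  interpret cring "mpoly_ring n :: (_ \<Rightarrow>\<^sub>0 'a) ring" by (rule cring_mpoly_ring)
  show "ring (mpoly_ring n :: (_ \<Rightarrow>\<^sub>0 'a) ring)" by (rule ring_axioms)
  show "subgroup (monom_span S) (add_monoid (mpoly_ring n :: (_ \<Rightarrow>\<^sub>0 'a) ring))"
  proof (rule add.subgroupI)
    show "monom_span S \<subseteq> carrier (mpoly_ring n :: (_ \<Rightarrow>\<^sub>0 'a) ring)"
      using monom_span_mono[OF assms(1)] by simp
    show "monom_span S \<noteq> ({} :: (_ \<Rightarrow>\<^sub>0 'a) set)"
      using zero_in_monom_span by blast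
    fix f g :: "(nat \<Rightarrow>\<^sub>0 nat) \<Rightarrow>\<^sub>0 'a" assume f: "f \<in> monom_span S"
    show "f \<oplus>\<^bsub>mpoly_ring n\<^esub> g \<in> monom_span S" if "g \<in> monom_span S"
      using f that by (simp add: add_in_monom_span)
    have "f \<in> monom_span (exps n)"
      using f monom_span_mono[OF assms(1)] by blast
    then have "\<ominus>\<^bsub>mpoly_ring n\<^esub> f = - f"
      by (intro minus_equality) (simp_all add: uminus_in_monom_span)
    then show "\<ominus>\<^bsub>mpoly_ring n\<^esub> f \<in> monom_span S"
      using f by (simp add: uminus_in_monom_span)
  qed
next
  fix f g :: "(nat \<Rightarrow>\<^sub>0 nat) \<Rightarrow>\<^sub>0 'a"
  assume "f \<in> monom_span S" "g \<in> carrier (mpoly_ring n)"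
  then have "f * g \<in> monom_span S"
    using mult_in_monom_span[of f S g "exps n"] monom_span_mono[OF assms(2)] by auto
  then show "g \<otimes>\<^bsub>mpoly_ring n\<^esub> f \<in> monom_span S" "f \<otimes>\<^bsub>mpoly_ring n\<^esub> g \<in> monom_span S"
    by (simp_all add: mult.commute)
qed

section \<open>Dickson's lemma\<close>

text \<open>
  Every sequence in a linear order has a monotone subsequence; a decreasing one of natural numbers is constant from
  the place where it attains its minimum.
\<close>

lemma nat_seq_mono_subseq:
  fixes s :: "nat \<Rightarrow> nat"
  shows "\<exists>g :: nat \<Rightarrow> nat. strict_mono g \<and> mono (\<lambda>k. s (g k))"
proof -
  obtain g :: "nat \<Rightarrow> nat" where g: "strict_mono g" "monoseq (\<lambda>k. s (g k))"
    using seq_monosub by blast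
  then consider "mono (\<lambda>k. s (g k))" | "antimono (\<lambda>k. s (g k))"
    by (auto simp: monoseq_iff)
  then show ?thesis
  proof cases
    case 1
    with g show ?thesis by blast
  next
    case 2
    obtain k0 where k0: "\<And>k. s (g k0) \<le> s (g k)"
      using ex_has_least_nat[of "\<lambda>_. True" 0 "\<lambda>k. s (g k)"] by auto
    have "s (g (k0 + k)) = s (g k0)" for k
      using k0[of "k0 + k"] antimonoD[OF 2, of k0 "k0 + k"] by simp
    then have "mono (\<lambda>k. s (g (k0 + k)))"
      by (simp add: mono_def)
    moreover have "strict_mono (\<lambda>k. g (k0 + k))"
      using g(1) by (simp add: strict_mono_def)
    ultimately show ?thesis by blast
  qed
qed

lemma coordinatewise_mono_subseq:
  fixes u :: "nat \<Rightarrow> 'v \<Rightarrow> nat"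
  assumes "finite V"
  shows "\<exists>g :: nat \<Rightarrow> nat. strict_mono g \<and> (\<forall>v\<in>V. mono (\<lambda>k. u (g k) v))"
  using assms
proof (induction V rule: finite_induct)
  case empty
  show ?case by (intro exI[of _ id]) (simp add: strict_mono_def)
next
  case (insert v V)
  then obtain g :: "nat \<Rightarrow> nat" where g: "strict_mono g" "\<forall>v\<in>V. mono (\<lambda>k. u (g k) v)"
    by blast
  obtain h :: "nat \<Rightarrow> nat" where h: "strict_mono h" "mono (\<lambda>k. u (g (h k)) v)"
    using nat_seq_mono_subseq[of "\<lambda>k. u (g k) v"] by blast
  have "strict_mono (\<lambda>k. g (h k))"
    using g(1) h(1) by (simp add: strict_mono_def)
  moreover have "mono (\<lambda>k. u (g (h k)) w)" if "w \<in> V" for w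
    using g(2) h(1) that by (simp add: mono_def strict_mono_less_eq)
  ultimately show ?case
    using h(2) by blast
qed

text \<open>
  Componentwise comparison of exponents is a well-quasi-order: along a subsequence that increases
  in each of the \<open>n\<close> coordinates, the first term divides the second. Both the finiteness
  and the termination argument below rest on this.
\<close>

lemma dickson_sequence:
  fixes s :: "nat \<Rightarrow> nat \<Rightarrow>\<^sub>0 nat"
  assumes "\<And>k. s k \<in> exps n"
  obtains i j e where "i < j" and "e \<in> exps n" and "s j = s i + e"
proof -
  obtain g :: "nat \<Rightarrow> nat" where g: "strict_mono g" "\<forall>v\<in>{1..n}. mono (\<lambda>k. lookup (s (g k)) v)"
    using coordinatewise_mono_subseq[of "{1..n}" "\<lambda>k. lookup (s k)"] by auto
  have "lookup (s (g 0)) v \<le> lookup (s (g 1)) v" for v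
  proof (cases "v \<in> {1..n}")
    case True
    then show ?thesis using g(2) by (auto dest: monoD)
  next
    case False
    then show ?thesis using assms by (simp add: exps_iff)
  qed
  then have eq: "s (g 1) = s (g 0) + (s (g 1) - s (g 0))"
    by (intro poly_mapping_eqI) (simp add: lookup_add lookup_minus)
  moreover have "s (g 1) - s (g 0) \<in> exps n"
    using assms[of "g 1"] by (subst (asm) eq) (simp add: add_in_exps_iff)
  moreover have "g 0 < g 1"
    using g(1) by (simp add: strict_mono_def)
  ultimately show thesis
    using that by blast
qed

text \<open>
  The order \<open>\<le>\<close> on exponents is the lexicographic one, in which \<open>0\<close> is least because no coordinate is
  negative.
\<close>

lemma exponent_le_add: "a \<le> a + (e :: nat \<Rightarrow>\<^sub>0 nat)"
proof -
  have "\<not> e < 0"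
    by transfer (simp add: less_fun_def)
  then show ?thesis
    using add_left_mono[of 0 e a] by simp
qed

text \<open>
  In an infinite lexicographic descent some term would divide a later one, hence be at most that
  term. The bound \<open>n\<close> on the variables is essential: \<open>x\<^sub>1 > x\<^sub>2 > \<dots>\<close> descends forever.
\<close>

lemma wf_less_exps: "wf {(a, b). a < b \<and> a \<in> exps n \<and> b \<in> exps n}"
  unfolding wf_iff_no_infinite_down_chain
proof
  assume "\<exists>s. \<forall>i. (s (Suc i), s i) \<in> {(a, b). a < b \<and> a \<in> exps n \<and> b \<in> exps n}"
  then obtain s where s: "\<And>i. s (Suc i) < s i" "\<And>i. s i \<in> exps n"
    by auto
  obtain i j e where ij: "i < j" "s j = s i + e"
    by (rule dickson_sequence[of s n, OF s(2)])
  have "s i \<le> s j"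
    using ij(2) exponent_le_add by simp
  moreover have "s j < s i"
    using ij(1)
  proof (induction j)
    case (Suc k)
    then show ?case
      using s(1)[of k] by (metis less_Suc_eq order.strict_trans)
  qed simp
  ultimately show False by simp
qed


text \<open>
  The finite set consists of the elements of \<open>L\<close> that are minimal for divisibility. If it were infinite, one
  of its members would properly divide another.
\<close>

lemma dickson:
  assumes "L \<subseteq> exps n"
  shows "\<exists>F\<subseteq>L. finite F \<and> L \<subseteq> F + exps n"
proof -
  define F where "F = {a \<in> L. \<forall>b\<in>L. \<forall>e\<in>exps n. a = b + e \<longrightarrow> b = a}"
  have "F \<subseteq> L"
    by (auto simp: F_def)
  moreover have "finite F"
  proof (rule ccontr)
    assume "infinite F"
    then obtain s :: "nat \<Rightarrow> nat \<Rightarrow>\<^sub>0 nat" where s: "inj s" "\<And>k. s k \<in> F"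
      using infinite_countable_subset[of F] by blast
    then obtain i j e where "i < j" "e \<in> exps n" "s j = s i + e"
      using dickson_sequence[of s n] \<open>F \<subseteq> L\<close> assms by blast
    then have "s i = s j"
      using s(2)[of i] s(2)[of j] unfolding F_def by blast
    with \<open>i < j\<close> s(1) show False
      by (auto dest: injD)
  qed
  moreover have "a \<in> F + exps n" if "a \<in> L" for a
    using wf_less_exps[of n] that
  proof (induction a rule: wf_induct_rule)
    case (less a)
    show ?case
    proof (cases "a \<in> F")
      case True
      then show ?thesis
        using zero_in_exps[of n] by (metis add.right_neutral set_plus_intro)
    next
      case False
      then obtain b e where b: "b \<in> L" "e \<in> exps n" "a = b + e" "b \<noteq> a"
        using less.prems by (auto simp: F_def)
      then have "b < a"
        using exponent_le_add[of b e] by (metis order_le_imp_less_or_eq)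
      then have "b \<in> F + exps n"
        using less b assms by blast
      then have "a \<in> F + exps n + exps n"
        using b by auto
      then show ?thesis
        by (simp add: add.assoc exps_add_exps)
    qed
  qed
  ultimately show ?thesis by blast
qed

section \<open>Hilbert's basis theorem\<close>

lemma lookup_single_mult:
  fixes g :: "(nat \<Rightarrow>\<^sub>0 nat) \<Rightarrow>\<^sub>0 'k::field"
  shows "lookup (single e c * g) (e + b) = c * lookup g b"
proof -
  have "lookup (single e c * g) (e + b)
      = (\<Sum>l. ((c * (\<Sum>q. (lookup g q when e + b = l + q))) when e = l))"
    by (simp add: lookup_mult lookup_single when_mult)
  also have "\<dots> = c * (\<Sum>q. (lookup g q when b = q))"
    by (simp only: Sum_any_when_equal' add_left_cancel)
  finally show ?thesis by simp
qed

text \<open>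
  If the leading monomial of \<open>g\<close> divides that of \<open>f\<close>, a multiple of \<open>g\<close> cancels the leading term of \<open>f\<close>.
  No larger exponent appears because addition of exponents preserves the order. The
  conclusion quantifies over the exponents since the difference may be zero and then has no leading one.
\<close>

lemma lead_cancel:
  fixes f g :: "(nat \<Rightarrow>\<^sub>0 nat) \<Rightarrow>\<^sub>0 'k::field"
  assumes "f \<noteq> 0" and "g \<noteq> 0"
    and lead: "Max (keys f) = Max (keys g) + e"
  obtains c where "\<And>a. a \<in> keys (f + single e c * g) \<Longrightarrow> a < Max (keys f)"
proof -
  define a b where "a = Max (keys f)" and "b = Max (keys g)"
  have "b \<in> keys g"
    unfolding b_def using \<open>g \<noteq> 0\<close> by (intro Max_in) simp_all
  then have gb: "lookup g b \<noteq> 0"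
    by (simp add: in_keys_iff)
  \<comment> \<open>minus the quotient of the leading coefficients\<close>
  define c where "c = - (lookup f a / lookup g b)"
  have ab: "a = e + b"
    using lead by (simp add: a_def b_def add.commute)
  have "lookup (f + single e c * g) a = lookup f a + c * lookup g b"
    by (simp only: lookup_add) (simp only: ab lookup_single_mult)
  also have "\<dots> = 0"
    unfolding c_def using gb by simp
  finally have "lookup (f + single e c * g) a = 0" .
  moreover have "d \<le> a" if "d \<in> keys (f + single e c * g)" for d
  proof -
    have "d \<in> keys f \<or> d \<in> keys (single e c * g)"
      using that keys_add[of f "single e c * g"] by blast
    then show ?thesis
    proof
      assume "d \<in> keys f"
      then show ?thesis by (simp add: a_def)
    next
      assume "d \<in> keys (single e c * g)"
      then obtain d' where "d' \<in> keys g" "d = e + d'"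
        using keys_mult[of "single e c" g] by (auto split: if_splits)
      then show ?thesis
        by (simp add: ab b_def add_left_mono)
    qed
  qed
  ultimately have "d < a" if "d \<in> keys (f + single e c * g)" for d
    using that by (metis in_keys_iff order_le_imp_less_or_eq)
  then show thesis
    using that unfolding a_def by blast
qed

text \<open>
  Division algorithm: an element of \<open>I\<close> is reduced by multiples of elements of \<open>K\<close>, its leading exponent
  dropping at each step; the well-founded descent can only end at \<open>0\<close>.
\<close>

lemma ideal_eq_if_same_leads:
  assumes I: "ideal I (mpoly_ring n)" and K: "ideal K (mpoly_ring n)" and "K \<subseteq> I"
    and leads: "\<And>f. f \<in> I \<Longrightarrow> f \<noteq> 0 \<Longrightarrow>
      \<exists>g\<in>K. g \<noteq> 0 \<and> (\<exists>e\<in>exps n. Max (keys f) = Max (keys g) + e)"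
  shows "I = (K :: ((nat \<Rightarrow>\<^sub>0 nat) \<Rightarrow>\<^sub>0 'k::field) set)"
proof
  interpret I: ideal I "mpoly_ring n :: ((nat \<Rightarrow>\<^sub>0 nat) \<Rightarrow>\<^sub>0 'k) ring" by fact
  interpret K: ideal K "mpoly_ring n :: ((nat \<Rightarrow>\<^sub>0 nat) \<Rightarrow>\<^sub>0 'k) ring" by fact
  have lead_exps: "Max (keys f) \<in> exps n" if "f \<in> I" "f \<noteq> 0" for f
  proof -
    have "Max (keys f) \<in> keys f"
      using that(2) by (intro Max_in) simp_all
    then show ?thesis
      using I.Icarr[OF that(1)] by (auto simp: monom_span_def)
  qed
  have "f \<in> K" if "f \<in> I" "f \<noteq> 0" "Max (keys f) = a" for f a
    using wf_less_exps[of n] that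
  proof (induction a arbitrary: f rule: wf_induct_rule)
    case (less a)
    obtain g e where g: "g \<in> K" "g \<noteq> 0" and e: "e \<in> exps n"
      and lead: "Max (keys f) = Max (keys g) + e"
      using leads less.prems by blast
    obtain c where c: "\<And>d. d \<in> keys (f + single e c * g) \<Longrightarrow> d < Max (keys f)"
      using lead_cancel[OF \<open>f \<noteq> 0\<close> \<open>g \<noteq> 0\<close> lead] by blast
    have monom_mult: "single e c' * g \<in> K" for c'
      using K.I_l_closed[OF g(1), of "single e c'"] e by (simp add: single_in_monom_span_iff)
    define h where "h = f + single e c * g"
    have "h \<in> I"
      using additive_subgroup.a_closed[OF ideal.axioms(1)[OF I], of f "single e c * g"]
        less.prems(1) monom_mult[of c] \<open>K \<subseteq> I\<close>
      by (simp add: h_def subset_iff)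
    have "h \<in> K"
    proof (cases "h = 0")
      case True
      then show ?thesis using additive_subgroup.zero_closed[OF ideal.axioms(1)[OF K]] by simp
    next
      case False
      then have "Max (keys h) < a"
        using c Max_in[of "keys h"] less.prems(3) by (simp add: h_def)
      then show ?thesis
        using less.IH[of "Max (keys h)" h] \<open>h \<in> I\<close> False
          lead_exps[of h] lead_exps[of f] less.prems by simp
    qed
    then have "h + single e (- c) * g \<in> K"
      using additive_subgroup.a_closed[OF ideal.axioms(1)[OF K], of h "single e (- c) * g"] monom_mult[of "- c"] by simp
    moreover have "h + single e (- c) * g = f"
      by (simp add: h_def single_uminus)
    ultimately show ?case by simp
  qed
  moreover have "0 \<in> K"
    using additive_subgroup.zero_closed[OF ideal.axioms(1)[OF K]] by simp
  ultimately show "I \<subseteq> K"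
    by blast
qed fact

theorem noetherian_mpoly_ring: "noetherian_ring (mpoly_ring n :: ((nat \<Rightarrow>\<^sub>0 nat) \<Rightarrow>\<^sub>0 'k::field) ring)"
proof -
  interpret cring "mpoly_ring n :: ((nat \<Rightarrow>\<^sub>0 nat) \<Rightarrow>\<^sub>0 'k) ring" by (rule cring_mpoly_ring)
  show ?thesis
  proof (rule noetherian_ringI)
    fix I :: "((nat \<Rightarrow>\<^sub>0 nat) \<Rightarrow>\<^sub>0 'k) set" assume I: "ideal I (mpoly_ring n)"
    have carr: "I \<subseteq> carrier (mpoly_ring n)"
      using ideal.Icarr[OF I] by blast
    define lead where "lead f = Max (keys f)" for f :: "(nat \<Rightarrow>\<^sub>0 nat) \<Rightarrow>\<^sub>0 'k"
    have "lead ` (I - {0}) \<subseteq> exps n"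
    proof (rule image_subsetI)
      fix f assume "f \<in> I - {0}"
      then have "f \<in> I" "f \<noteq> 0"
        by auto
      then have "lead f \<in> keys f"
        using Max_in[of "keys f"] by (simp add: lead_def)
      moreover have "keys f \<subseteq> exps n"
        using carr \<open>f \<in> I\<close> by (auto simp: monom_span_def)
      ultimately show "lead f \<in> exps n"
        by blast
    qed
    from dickson[OF this] obtain F where F: "F \<subseteq> lead ` (I - {0})" "finite F"
      "lead ` (I - {0}) \<subseteq> F + exps n"
      by blast
    then obtain A where A: "A \<subseteq> I - {0}" "finite A" "F = lead ` A"
      by (meson finite_subset_image)
    have sub: "A \<subseteq> Idl\<^bsub>mpoly_ring n\<^esub> A"
      using A carr by (intro genideal_self) blast
    have "I = Idl\<^bsub>mpoly_ring n\<^esub> A"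
    proof (rule ideal_eq_if_same_leads[OF I])
      show "ideal (Idl\<^bsub>mpoly_ring n\<^esub> A) (mpoly_ring n)"
        using A carr by (intro genideal_ideal) blast
      show "Idl\<^bsub>mpoly_ring n\<^esub> A \<subseteq> I"
        using A I by (intro genideal_minimal) auto
      fix f assume "f \<in> I" "f \<noteq> 0"
      then have "lead f \<in> lead ` A + exps n"
        using F(3) A(3) by blast
      then obtain g e where "g \<in> A" "e \<in> exps n" "lead f = lead g + e"
        by (auto simp: set_plus_def)
      then show "\<exists>g\<in>Idl\<^bsub>mpoly_ring n\<^esub> A. g \<noteq> 0 \<and>
          (\<exists>e\<in>exps n. Max (keys f) = Max (keys g) + e)"
        using sub A(1) unfolding lead_def by blast
    qed
    then show "\<exists>A\<subseteq>carrier (mpoly_ring n). finite A \<and> I = Idl\<^bsub>mpoly_ring n\<^esub> A"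
      using A carr by blast
  qed
qed

section \<open>Powers of the two ideals\<close>

text \<open>
  Both ideals are instances of \<open>(x\<^sub>1\<^sup>q, \<dots>, x\<^sub>m\<^sup>q)\<close>, which the parameter \<open>q\<close> allows to treat at once: \<open>wt m q a\<close>
  counts how many of these generators divide \<open>x\<^sup>a\<close> simultaneously, with multiplicity, and for \<open>q = 1\<close> it is
  the degree in \<open>x\<^sub>1, \<dots>, x\<^sub>m\<close>.
\<close>

definition wt :: "nat \<Rightarrow> nat \<Rightarrow> (nat \<Rightarrow>\<^sub>0 nat) \<Rightarrow> nat" where
  "wt m q a = (\<Sum>i=1..m. lookup a i div q)"

definition wt_exps :: "nat \<Rightarrow> nat \<Rightarrow> nat \<Rightarrow> nat \<Rightarrow> (nat \<Rightarrow>\<^sub>0 nat) set" where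
  "wt_exps n m q k = {a \<in> exps n. k \<le> wt m q a}"

lemma wt_zero [simp]: "wt m q 0 = 0"
  by (simp add: wt_def)

lemma wt_1_add: "wt m 1 (a + b) = wt m 1 a + wt m 1 b"
  by (simp add: wt_def lookup_add sum.distrib)

lemma wt_1_single: "i \<in> {1..m} \<Longrightarrow> wt m 1 (single i k) = k"
  by (simp add: wt_def lookup_single when_def)

lemma wt_add_ge: "wt m q a + wt m q b \<le> wt m q (a + b)"
  unfolding wt_def sum.distrib[symmetric] lookup_add
  by (rule sum_mono) (metis div_add1_eq le_add1)

lemma wt_add_single:
  assumes "q > 0" and "i \<in> {1..m}"
  shows "wt m q (a + single i q) = wt m q a + 1"
proof -
  have "lookup (a + single i q) j div q = lookup a j div q + (if j = i then 1 else 0)" for j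
    using assms by (simp add: lookup_add lookup_single when_def)
  then show ?thesis
    using assms by (simp add: wt_def sum.distrib)
qed

lemma mult_wt_le: "q * wt m q a \<le> wt m 1 a"
  unfolding wt_def sum_distrib_left by (intro sum_mono) simp

lemma wt_pos_decompose:
  assumes "wt m q a > 0"
  obtains i b where "i \<in> {1..m}" and "a = b + single i q"
proof -
  obtain i where i: "i \<in> {1..m}" "lookup a i div q > 0"
    using assms unfolding wt_def by (metis gr0I not_less_zero sum.neutral)
  then have "q \<le> lookup a i"
    by (metis div_less not_le less_irrefl)
  then have "a = (a - single i q) + single i q"
    by (intro poly_mapping_eqI) (auto simp: lookup_add lookup_minus lookup_single when_def)
  then show thesis
    using i that by blast
qed

text \<open>
  The factor \<open>x\<^sup>b\<close> is built as a product of \<open>s\<close> generators \<open>x\<^sub>i\<^sup>q\<close>, so that both its weight and its degree are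
  known exactly. Since its exponents are multiples of \<open>q\<close>, no weight is lost: the quotient keeps
  all the rest.
\<close>

lemma split_off_weight:
  assumes "q > 0" and "s \<le> wt m q a"
  shows "\<exists>b c. a = b + c \<and> wt m q b = s \<and> wt m 1 b = q * s \<and> wt m q a = s + wt m q c"
  using assms(2)
proof (induction s)
  case 0
  show ?case by (intro exI[of _ 0] exI[of _ a]) simp
next
  case (Suc s)
  then obtain b c where bc: "a = b + c" "wt m q b = s" "wt m 1 b = q * s" "wt m q a = s + wt m q c"
    by auto
  with Suc.prems have "wt m q c > 0"
    by simp
  then obtain i d where i: "i \<in> {1..m}" and c: "c = d + single i q"
    by (rule wt_pos_decompose)
  have "a = (b + single i q) + d"
    by (simp add: bc(1) c ac_simps)
  moreover have "wt m q (b + single i q) = Suc s" "wt m q a = Suc s + wt m q d"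
    using bc wt_add_single[OF \<open>q > 0\<close> i] by (simp_all add: c)
  moreover have "wt m 1 (b + single i q) = q * Suc s"
    using bc(3) wt_1_single[OF i] by (simp only: wt_1_add) simp
  ultimately show ?case by blast
qed

lemma wt_exps_add:
  assumes "q > 0"
  shows "wt_exps n m q j + wt_exps n m q k = wt_exps n m q (j + k)"
proof
  show "wt_exps n m q j + wt_exps n m q k \<subseteq> wt_exps n m q (j + k)"
  proof
    fix a assume "a \<in> wt_exps n m q j + wt_exps n m q k"
    then obtain b c where "b \<in> wt_exps n m q j" "c \<in> wt_exps n m q k" "a = b + c"
      by (auto simp: set_plus_def)
    then show "a \<in> wt_exps n m q (j + k)"
      using wt_add_ge[of m q b c] by (simp add: wt_exps_def add_in_exps_iff)
  qed
  show "wt_exps n m q (j + k) \<subseteq> wt_exps n m q j + wt_exps n m q k"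
  proof
    fix a assume a: "a \<in> wt_exps n m q (j + k)"
    then obtain b c where bc: "a = b + c" "wt m q b = j" "wt m q a = j + wt m q c"
      using split_off_weight[OF assms, of j m a] by (auto simp: wt_exps_def)
    then have "b \<in> wt_exps n m q j" "c \<in> wt_exps n m q k"
      using a by (auto simp: wt_exps_def add_in_exps_iff)
    then show "a \<in> wt_exps n m q j + wt_exps n m q k"
      using bc(1) by auto
  qed
qed

lemma wt_exps_0: "wt_exps n m q 0 = exps n"
  by (simp add: wt_exps_def)

text \<open>
  The combinatorial core of the demotion identity. For the inclusion from right to left, splitting
  off \<open>s\<close> generators \<open>x\<^sub>i\<^sup>q\<close> uses up degree exactly \<open>q * s\<close>, which leaves degree at least \<open>q * r\<close>.
\<close>

lemma degree_wt_exps_add: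
  assumes "q > 0"
  shows "wt_exps n m 1 (q * r) + wt_exps n m q s = wt_exps n m 1 (q * (r + s)) \<inter> wt_exps n m q s"
proof
  show "wt_exps n m 1 (q * r) + wt_exps n m q s \<subseteq> wt_exps n m 1 (q * (r + s)) \<inter> wt_exps n m q s"
  proof
    fix a assume "a \<in> wt_exps n m 1 (q * r) + wt_exps n m q s"
    then obtain b c where bc: "b \<in> wt_exps n m 1 (q * r)" "c \<in> wt_exps n m q s" "a = b + c"
      by (auto simp: set_plus_def)
    have "q * s \<le> wt m 1 c"
      using bc(2) mult_wt_le[of q m c] by (auto simp: wt_exps_def intro: order_trans mult_le_mono2)
    then have "q * (r + s) \<le> wt m 1 a"
      using bc by (simp only: wt_1_add) (simp add: wt_exps_def distrib_left)
    moreover have "s \<le> wt m q a"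
      using bc wt_add_ge[of m q b c] by (simp add: wt_exps_def)
    ultimately show "a \<in> wt_exps n m 1 (q * (r + s)) \<inter> wt_exps n m q s"
      using bc by (simp add: wt_exps_def add_in_exps_iff)
  qed
  show "wt_exps n m 1 (q * (r + s)) \<inter> wt_exps n m q s \<subseteq> wt_exps n m 1 (q * r) + wt_exps n m q s"
  proof
    fix a assume a: "a \<in> wt_exps n m 1 (q * (r + s)) \<inter> wt_exps n m q s"
    then obtain b c where bc: "a = b + c" "wt m q b = s" "wt m 1 b = q * s"
      using split_off_weight[OF assms, of s m a] by (auto simp: wt_exps_def)
    have "q * (r + s) \<le> wt m 1 b + wt m 1 c"
      using a by (simp only: wt_1_add[symmetric] bc(1)[symmetric]) (simp add: wt_exps_def)
    then have "q * r \<le> wt m 1 c"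
      unfolding bc(3) distrib_left by simp
    then have "b \<in> wt_exps n m q s" "c \<in> wt_exps n m 1 (q * r)"
      using a bc by (auto simp: wt_exps_def add_in_exps_iff)
    then show "a \<in> wt_exps n m 1 (q * r) + wt_exps n m q s"
      using bc(1) by (metis add.commute set_plus_intro)
  qed
qed

lemma ideal_wt_exps:
  assumes "q > 0"
  shows "ideal (monom_span (wt_exps n m q k)) (mpoly_ring n)"
proof (rule ideal_monom_span)
  show "wt_exps n m q k + exps n \<subseteq> wt_exps n m q k"
    using wt_exps_add[OF assms, of n m k 0] by (simp add: wt_exps_0)
qed (auto simp: wt_exps_def)

lemma ideal_power_wt_exps:
  assumes "q > 0"
  shows "ideal_power (mpoly_ring n) (monom_span (wt_exps n m q j)) k
    = (monom_span (wt_exps n m q (j * k)) :: ((nat \<Rightarrow>\<^sub>0 nat) \<Rightarrow>\<^sub>0 'k::field) set)"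
proof (induction k)
  case 0
  show ?case by (simp add: ideals_set_def nat_pow_def wt_exps_0)
next
  case (Suc k)
  have "ideal_power (mpoly_ring n) (monom_span (wt_exps n m q j)) (Suc k)
      = monom_span (wt_exps n m q (j * k)) \<cdot>\<^bsub>mpoly_ring n\<^esub> (monom_span (wt_exps n m q j) :: (_ \<Rightarrow>\<^sub>0 'k) set)"
    using Suc by (simp add: ideals_set_def nat_pow_def)
  then show ?case
    by (simp add: ideal_prod_monom_span wt_exps_add[OF assms] add.commute)
qed

lemma Var_power: "Var i ^ q = single (single i q) 1"
  by (induction q) (simp_all add: Var_def mult_single flip: single_add)

lemma genideal_Var_powers:
  assumes "q > 0" and "m \<le> n"
  shows "Idl\<^bsub>mpoly_ring n\<^esub> {Var i ^ q | i. i \<in> {1..m}}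
    = (monom_span (wt_exps n m q 1) :: ((nat \<Rightarrow>\<^sub>0 nat) \<Rightarrow>\<^sub>0 'k::field) set)"
proof
  interpret cring "mpoly_ring n :: ((nat \<Rightarrow>\<^sub>0 nat) \<Rightarrow>\<^sub>0 'k) ring" by (rule cring_mpoly_ring)
  let ?G = "{Var i ^ q | i. i \<in> {1..m}} :: ((nat \<Rightarrow>\<^sub>0 nat) \<Rightarrow>\<^sub>0 'k) set"
  let ?M = "monom_span (wt_exps n m q 1) :: ((nat \<Rightarrow>\<^sub>0 nat) \<Rightarrow>\<^sub>0 'k) set"
  have "single i q \<in> wt_exps n m q 1" if "i \<in> {1..m}" for i
    using wt_add_single[OF assms(1) that, of 0] single_in_exps[of i n q] that assms(2)
    by (simp add: wt_exps_def)
  then have G: "?G \<subseteq> ?M"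
    by (auto simp: Var_power single_in_monom_span_iff)
  show "Idl\<^bsub>mpoly_ring n\<^esub> ?G \<subseteq> ?M"
    using G by (rule genideal_minimal[OF ideal_wt_exps[OF assms(1)]])
  have carr: "?G \<subseteq> carrier (mpoly_ring n)"
    using G ideal.Icarr[OF ideal_wt_exps[OF assms(1)]] by blast
  interpret Idl: ideal "Idl\<^bsub>mpoly_ring n\<^esub> ?G" "mpoly_ring n :: ((nat \<Rightarrow>\<^sub>0 nat) \<Rightarrow>\<^sub>0 'k) ring"
    by (rule genideal_ideal[OF carr])
  note subgroup = Idl.additive_subgroup_axioms
  show "?M \<subseteq> Idl\<^bsub>mpoly_ring n\<^esub> ?G"
  proof (rule monom_span_subsetI)
    show "0 \<in> Idl\<^bsub>mpoly_ring n\<^esub> ?G"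
      using additive_subgroup.zero_closed[OF subgroup] by simp
    show "f + g \<in> Idl\<^bsub>mpoly_ring n\<^esub> ?G" if "f \<in> Idl\<^bsub>mpoly_ring n\<^esub> ?G" "g \<in> Idl\<^bsub>mpoly_ring n\<^esub> ?G" for f g
      using additive_subgroup.a_closed[OF subgroup that] by simp
    show "single a c \<in> Idl\<^bsub>mpoly_ring n\<^esub> ?G" if a: "a \<in> wt_exps n m q 1" for a and c :: 'k
    proof -
      obtain i b where i: "i \<in> {1..m}" and ab: "a = b + single i q"
        using a wt_pos_decompose[of m q a] by (auto simp: wt_exps_def)
      have "Var i ^ q \<in> Idl\<^bsub>mpoly_ring n\<^esub> ?G"
        using i genideal_self[OF carr] by blast
      moreover have "single b c \<in> carrier (mpoly_ring n)"
        using a by (simp add: ab wt_exps_def add_in_exps_iff single_in_monom_span_iff)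
      ultimately have "single b c * Var i ^ q \<in> Idl\<^bsub>mpoly_ring n\<^esub> ?G"
        using Idl.I_l_closed by fastforce
      then show ?thesis
        by (simp add: Var_power mult_single ab)
    qed
  qed
qed

section \<open>The demotion of a power of a monomial prime\<close>

theorem proposition4p3:
  fixes R :: "((nat \<Rightarrow>\<^sub>0 nat) \<Rightarrow>\<^sub>0 'k::field) ring"
    and m n :: nat
    and \<pp> J :: "((nat \<Rightarrow>\<^sub>0 nat) \<Rightarrow>\<^sub>0 'k) set"
  assumes "1 \<le> m" and "m \<le> n"
    and "R = mpoly_ring n"
    and "\<pp> = Idl\<^bsub>R\<^esub> {Var i | i. i \<in> {1..m}}"
    and "J = Idl\<^bsub>R\<^esub> {Var i [^]\<^bsub>R\<^esub> m | i. i \<in> {1..m}}"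
  shows "demotion R J (ideal_power R \<pp> m)
         \<and> (m > 1 \<longrightarrow> proper_demotion R J (ideal_power R \<pp> m))"
proof -
  have "m > 0"
    using assms(1) by simp
  have p: "\<pp> = monom_span (wt_exps n m 1 1)"
    using genideal_Var_powers[of 1 m n, where 'k = 'k] assms(2,3,4) by simp
  have J: "J = monom_span (wt_exps n m m 1)"
    using genideal_Var_powers[OF \<open>m > 0\<close> assms(2), where 'k = 'k] assms(3,5) by simp
  have pm: "ideal_power R \<pp> m = monom_span (wt_exps n m 1 m)"
    using ideal_power_wt_exps[of 1 n m 1 m, where 'k = 'k] by (simp add: p assms(3))
  have pmr: "ideal_power R (ideal_power R \<pp> m) r = monom_span (wt_exps n m 1 (m * r))" for r
    using ideal_power_wt_exps[of 1 n m m r, where 'k = 'k] by (simp add: pm) (simp add: assms(3))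
  have Js: "ideal_power R J s = monom_span (wt_exps n m m s)" for s
    using ideal_power_wt_exps[OF \<open>m > 0\<close>, of n m 1 s, where 'k = 'k] by (simp add: J assms(3))
  have inter: "monom_span (S \<inter> T) = (monom_span S \<inter> monom_span T :: (_ \<Rightarrow>\<^sub>0 'k) set)" for S T
    by (auto simp: monom_span_def)
  have dem: "demotion R J (ideal_power R \<pp> m)"
    unfolding demotion_def
  proof (intro conjI allI)
    show "cring R" "noetherian_ring R"
      by (simp_all add: assms(3) cring_mpoly_ring noetherian_mpoly_ring)
    show "ideal (ideal_power R \<pp> m) R"
      unfolding pm unfolding assms(3) by (rule ideal_wt_exps) simp
    show "ideal J R"
      unfolding J assms(3) by (rule ideal_wt_exps) fact
    have "a \<in> wt_exps n m 1 m" if "a \<in> wt_exps n m m 1" for a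
    proof -
      have "m * 1 \<le> m * wt m m a"
        using that by (intro mult_le_mono2) (simp add: wt_exps_def)
      also have "\<dots> \<le> wt m 1 a"
        by (rule mult_wt_le)
      finally show ?thesis
        using that by (simp add: wt_exps_def)
    qed
    then show "J \<subseteq> ideal_power R \<pp> m"
      unfolding pm J by (intro monom_span_mono) blast
    show "ideal_power R (ideal_power R \<pp> m) r \<cdot>\<^bsub>R\<^esub> ideal_power R J s
        = ideal_power R (ideal_power R \<pp> m) (r + s) \<inter> ideal_power R J s" for r s
      unfolding pmr Js inter[symmetric] degree_wt_exps_add[OF \<open>m > 0\<close>, symmetric]
      by (simp add: assms(3) ideal_prod_monom_span)
  qed
  moreover have "J \<noteq> ideal_power R \<pp> m" if "m > 1"
  proof -
    \<comment> \<open>The monomial \<open>x\<^sub>1\<^sup>m\<^sup>-\<^sup>1 x\<^sub>2\<close> has degree \<open>m\<close> but is divisible by no \<open>x\<^sub>i\<^sup>m\<close>.\<close>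
    define a where "a = single (1::nat) (m - 1) + single 2 1"
    have "lookup a i < m" for i :: nat
      using that by (auto simp: a_def lookup_add lookup_single when_def)
    then have "wt m m a = 0"
      by (simp add: wt_def)
    then have "single a 1 \<notin> J"
      by (simp add: J single_in_monom_span_iff wt_exps_def)
    have "1 \<in> {1..m}" "2 \<in> {1..m}"
      using that by auto
    then have "wt m 1 a = m"
      unfolding a_def wt_1_add by (simp only: wt_1_single) (use that in simp)
    moreover have "a \<in> exps n"
      using that assms(2) by (simp add: a_def add_in_exps_iff single_in_exps)
    ultimately have "single a 1 \<in> ideal_power R \<pp> m"
      unfolding pm by (simp add: single_in_monom_span_iff wt_exps_def)
    with \<open>single a 1 \<notin> J\<close> show ?thesis by blast
  qed
  ultimately show ?thesis
    by (simp add: proper_demotion_def)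
qed

end
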